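(* Let $$\begin{aligned}p_4(k)=\;&582076609134674072265625k^{40}-347825698554515838623046875k^{38}\\&+100074581801891326904296875000k^{36}-18656729921698570251464843750000k^{34}\\&+2406402165103435516357421875000000k^{32}-223881811253170562744140625000000000k^{30}\\&+13463175828870323610839843750000000000k^{28}-546554928845186341347265625000000000000k^{26}\\&+44602844570033253018161875000000000000000k^{24}-5130242398470886015317438950000000000000000k^{22}\\&+805214383330095009369880969748800000000000000k^{20}+8091804003905867976154901735852032000000000000k^{18}\\&-262076670696960781271382283372767764480000000000k^{16}\\&+483089080872113925346827615868453187944448000000000k^{14}\\&+76133654804831682593043073614469922630706135040000000k^{12}\\&+4656778296665388277933286028092539858012767959121920000k^{10}\\&+144475786697302680271016689740018636544036558347226316800k^8\\&+2305862812061518538327375046497265994061106944720616030208k^6\\&+14131109130840787698067340120866948829204788093469111353344k^4\\&-27802797644590317388762803455393575731200000000000000000000k^2\\&+9774552621457470122500000000000000000000000000000000000000,\end{aligned}$$ and $$\begin{aligned}p_2(t)=\;&91750400t^{20}-857210880t^{19}+3560046592t^{18}-8616673280t^{17}+13364330496t^{16}\\&-13704527872t^{15}+9174425600t^{14}-3719282688t^{13}+689182720t^{12}+53528576t^{11}\\&-36429312t^{10}+533760t^9+207104t^8+75520t^7+32352t^6+11376t^5-320t^4\\&-104t^3-30t^2-7t-1.\end{aligned}$$ Let $k_0\approx 0.6898369707\in\left(\frac12,\frac{9}{13}\right)$ be the root of $p_4(k)=0$ in that interval, and let $t_1\approx 0.5194285605\in\left(\frac12,\frac35\right)$ be the root of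 $p_2(t)=0$ in that interval. If $k\le k_0$, then for every triangle $$p\ \ge\ 3\sqrt{3}\,r+k\left[1-\left(\frac{2r}{R}\right)^{5}\right]r.$$ Equality holds if and only if $a:b:c=1:1:1$ (for any $k\le k_0$), or $k=k_0$ and $a:b:c=2t_1:1:1$.
   Context: For a triangle $ABC$, $a,b,c$ denote the side lengths, $p=\frac{a+b+c}{2}$ the semi-perimeter, $R$ the circumradius and $r$ the inradius. *)

theory Defs
  imports Complex_Main
begin

definition p4 :: "real \<Rightarrow> real" where
"p4 k = 582076609134674072265625*k^40 - 347825698554515838623046875*k^38
 + 100074581801891326904296875000*k^36 - 18656729921698570251464843750000*k^34
 + 2406402165103435516357421875000000*k^32 - 223881811253170562744140625000000000*k^30
 + 13463175828870323610839843750000000000*k^28 - 546554928845186341347265625000000000000*k^26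
 + 44602844570033253018161875000000000000000*k^24 - 5130242398470886015317438950000000000000000*k^22
 + 805214383330095009369880969748800000000000000*k^20 + 8091804003905867976154901735852032000000000000*k^18
 - 262076670696960781271382283372767764480000000000*k^16
 + 483089080872113925346827615868453187944448000000000*k^14
 + 76133654804831682593043073614469922630706135040000000*k^12
 + 4656778296665388277933286028092539858012767959121920000*k^10
 + 144475786697302680271016689740018636544036558347226316800*k^8
 + 2305862812061518538327375046497265994061106944720616030208*k^6
 + 14131109130840787698067340120866948829204788093469111353344*k^4
 - 27802797644590317388762803455393575731200000000000000000000*k^2
 + 9774552621457470122500000000000000000000000000000000000000"

definition p2 :: "real \<Rightarrow> real" where
"p2 t = 91750400*t^20 - 857210880*t^19 + 3560046592*t^18 - 8616673280*t^17 + 13364330496*t^16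
 - 13704527872*t^15 + 9174425600*t^14 - 3719282688*t^13 + 689182720*t^12 + 53528576*t^11
 - 36429312*t^10 + 533760*t^9 + 207104*t^8 + 75520*t^7 + 32352*t^6 + 11376*t^5 - 320*t^4
 - 104*t^3 - 30*t^2 - 7*t - 1"

definition is_triangle :: "real \<Rightarrow> real \<Rightarrow> real \<Rightarrow> bool" where
"is_triangle a b c \<longleftrightarrow> a > 0 \<and> b > 0 \<and> c > 0 \<and> a < b + c \<and> b < a + c \<and> c < a + b"

definition semiperim :: "real \<Rightarrow> real \<Rightarrow> real \<Rightarrow> real" where
"semiperim a b c = (a + b + c) / 2"

definition tri_area :: "real \<Rightarrow> real \<Rightarrow> real \<Rightarrow> real" where
"tri_area a b c = (let s = semiperim a b c in sqrt (s * (s - a) * (s - b) * (s - c)))"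

definition inradius :: "real \<Rightarrow> real \<Rightarrow> real \<Rightarrow> real" where
"inradius a b c = tri_area a b c / semiperim a b c"

definition circumradius :: "real \<Rightarrow> real \<Rightarrow> real \<Rightarrow> real" where
"circumradius a b c = a * b * c / (4 * tri_area a b c)"

end

theory Submission
  imports Defs "HOL-Computational_Algebra.Polynomial"
begin

text \<open>
  For a fixed value of \<open>x = 2r/R\<close> Blundon's inequality bounds \<open>p/r\<close> from below by its value on the
  isosceles triangle \<open>2t : 1 : 1\<close> with \<open>t \<ge> 1/2\<close>. The substitution
  \<open>v = sqrt ((1 + t) / (3 (1 - t)))\<close> removes all radicals: with \<open>y = 3v\<^sup>2 - 1\<close> and
  \<open>z = 3v\<^sup>2 + 1\<close> one gets \<open>p/r = sqrt 3 \<cdot> 6v\<^sup>3/y\<close> and \<open>x = 8y/z\<^sup>2\<close>, so the best constant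
  is \<open>sqrt 3\<close> times the minimum over \<open>v > 1\<close> of a rational function. Its derivative has the sign of a
  polynomial of degree 20 that is increasing for \<open>v \<ge> 1\<close>, hence there is one critical point, where
  the minimum equals \<open>N/(5y)\<close> with the cubic \<open>N = 33v\<^sup>3 - 45v\<^sup>2 + v + 15\<close>.

  Up to constants, the polynomials of the statement are norms of simpler ones: \<open>p2 (y/z)\<close> times \<open>z\<^sup>2\<^sup>0\<close> is the product
  of the critical polynomial at \<open>v\<close> and \<open>-v\<close>, and \<open>p4 (2 sqrt 3/5 \<cdot> m)\<close> is the product of a degree 20
  polynomial at \<open>m\<close> and \<open>-m\<close>. That polynomial vanishes at \<open>m = N/(2y)\<close> and, by its coefficient
  signs, has only one positive root.
\<close>

subsection \<open>Polynomial identities\<close>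

text \<open>
  Started with \<open>T = 0\<close> and \<open>E = 1\<close>, this computes the sum of the \<open>c\<^sub>i f\<^sup>i g\<^sup>n\<^sup>-\<^sup>i\<close>, where \<open>n\<close> is the degree; the
  accumulator \<open>E\<close> holds the current power of \<open>f\<close>.
\<close>

fun homogenize :: "real list \<Rightarrow> real poly \<Rightarrow> real poly \<Rightarrow> real poly \<Rightarrow> real poly \<Rightarrow> real poly"
  where
  "homogenize [] f g T E = T"
| "homogenize (c # cs) f g T E = homogenize cs f g (g * T + smult c E) (f * E)"

text \<open>The accumulators are left general so that the induction goes through. The extra factor
  \<open>poly g x\<close> on the left avoids the exponent \<open>length cs - 1\<close>.\<close>

lemma poly_homogenize_acc:
  assumes "poly g x \<noteq> 0"
  shows "poly (homogenize cs f g T E) x * poly g x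
    = poly g x ^ length cs * (poly T x * poly g x + poly E x * poly (Poly cs) (poly f x / poly g x))"
proof (induction cs arbitrary: T E)
  case Nil
  then show ?case by simp
next
  case (Cons c cs)
  with assms show ?case
    by (simp add: field_simps)
qed

lemma poly_homogenize_eq_0_iff:
  assumes "poly g x \<noteq> 0"
  shows "poly (homogenize cs f g 0 1) x = 0 \<longleftrightarrow> poly (Poly cs) (poly f x / poly g x) = 0"
  using poly_homogenize_acc[OF assms, of cs f 0 1] assms by auto

definition crit :: "real poly" where
  "crit = [:-163840, -502443, 1933311, 6946803, -7580367, -37224684, 6487452, 94063356, 26437428,
    -103501962, -56876094, 22950378, 16538094, 11363652, 7427052, 4487724, 2545668, 1240029,
    570807, 177147, 59049:]"

text \<open>
  Up to a constant factor, the resultant with respect to \<open>v\<close> of the critical polynomial and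
  \<open>33v\<^sup>3 - 45v\<^sup>2 + v + 15 - 2m(3v\<^sup>2 - 1)\<close>, as a polynomial in \<open>m\<close>.
\<close>

definition val_coeffs :: "real list" where
  "val_coeffs = [23571571624279022216796875, 8426876798346664306640625, -14584998254504590400136810,
    -11406852333688801136894307, -4664500615307803840463916, -1336671131725703492904492,
    -296532482131412172265410, -53389730078566328499570, -7993969257357798400647,
    -1007710320420233848836, -107492924622207363687, -9704288892629089035, -738731864602922490,
    -47071020076774173, -2481553244479509, -106396230657258, -3617132739345, -93835651635,
    -1745212878, -20726199, -118098]"

definition p4_coeffs :: "real list" where
  "p4_coeffs = [9774552621457470122500000000000000000000000000000000000000,
    -27802797644590317388762803455393575731200000000000000000000,
    14131109130840787698067340120866948829204788093469111353344,
    2305862812061518538327375046497265994061106944720616030208,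
    144475786697302680271016689740018636544036558347226316800,
    4656778296665388277933286028092539858012767959121920000,
    76133654804831682593043073614469922630706135040000000,
    483089080872113925346827615868453187944448000000000,
    -262076670696960781271382283372767764480000000000,
    8091804003905867976154901735852032000000000000,
    805214383330095009369880969748800000000000000, -5130242398470886015317438950000000000000000,
    44602844570033253018161875000000000000000, -546554928845186341347265625000000000000,
    13463175828870323610839843750000000000, -223881811253170562744140625000000000,
    2406402165103435516357421875000000, -18656729921698570251464843750000,
    100074581801891326904296875000, -347825698554515838623046875, 582076609134674072265625]"

definition p2_coeffs :: "real list" where
  "p2_coeffs = [-1, -7, -30, -104, -320, 11376, 32352, 75520, 207104, 533760, -36429312, 53528576,
    689182720, -3719282688, 9174425600, -13704527872, 13364330496, -8616673280, 3560046592,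
    -857210880, 91750400]"

lemma p4_eq_poly: "p4 k = poly (Poly p4_coeffs) (k\<^sup>2)"
  unfolding p4_def p4_coeffs_def by simp algebra

lemma p2_eq_poly: "p2 t = poly (Poly p2_coeffs) t"
  unfolding p2_def p2_coeffs_def by simp algebra

text \<open>Recentred at 1, only the constant coefficient is negative, which makes monotonicity for
  v >= 1 visible.\<close>

lemma crit_shift: "poly crit (1 + u) = poly [:-2621440, 62914560, 1122631680, 7381647360, 27810201600, 69414174720, 124339691520,
    169201778688, 183028377600, 162985955328, 122201519616, 77875395840, 42149403648,
    19237901760, 7318716768, 2281758336, 568707480, 109122552, 15155910, 1358127, 59049:] u"
proof -
  have "crit \<circ>\<^sub>p [:1, 1:] = [:-2621440, 62914560, 1122631680, 7381647360, 27810201600, 69414174720, 124339691520,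
    169201778688, 183028377600, 162985955328, 122201519616, 77875395840, 42149403648,
    19237901760, 7318716768, 2281758336, 568707480, 109122552, 15155910, 1358127, 59049:]"
    by (simp add: crit_def pcompose_pCons)
  from arg_cong[OF this, of "\<lambda>p. poly p u"] show ?thesis
    by (simp only: poly_pcompose) simp
qed

text \<open>Here the coefficients change sign once, between u^7 and u^8, which serves to exclude
  roots -v with v slightly above 1.\<close>

lemma crit_neg_shift: "poly crit (- 1 - u) = poly [:-2621440, -43253760, -310640640, -1271070720, -3244032000, -5255331840, -5023088640,
    -1522851840, 3242280960, 6477096960, 7282192896, 6333831936, 4571354880, 2757509568,
    1377914976, 562251456, 183235608, 46058220, 8424324, 1003833, 59049:] u"
proof -
  have "crit \<circ>\<^sub>p [:-1, -1:] = [:-2621440, -43253760, -310640640, -1271070720, -3244032000, -5255331840, -5023088640,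
    -1522851840, 3242280960, 6477096960, 7282192896, 6333831936, 4571354880, 2757509568,
    1377914976, 562251456, 183235608, 46058220, 8424324, 1003833, 59049:]"
    by (simp add: crit_def pcompose_pCons)
  from arg_cong[OF this, of "\<lambda>p. poly p u"] show ?thesis
    by (simp only: poly_pcompose) simp
qed

text \<open>The left side is what remains of the numerator of the derivative of \<open>bound\<close>
  after positive factors are removed; the triple zero at v = 1 is the equilateral case.\<close>

lemma crit_factorization:
  "v * (3 * v\<^sup>2 + 1) ^ 11 - 8 ^ 5 * (33 * v ^ 3 - 45 * v\<^sup>2 + v + 15) * (3 * v\<^sup>2 - 1) ^ 5
    = 3 * (v - 1) ^ 3 * poly crit v"
proof -
  have "[:0, 1:] * [:1, 0, 3:] ^ 11 - smult (8 ^ 5) ([:15, 1, -45, 33:] * [:-1, 0, 3:] ^ 5)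
      = smult 3 ([:-1, 1:] ^ 3 * crit)"
    by (simp add: crit_def power_numeral_reduce)
  from arg_cong[OF this, of "\<lambda>p. poly p v"] show ?thesis
    by (simp add: power2_eq_square power3_eq_cube algebra_simps)
qed

lemma p2_homogenized:
  "homogenize p2_coeffs [:-1, 0, 3:] [:1, 0, 3:] 0 1 = smult 2 (crit * (crit \<circ>\<^sub>p [:0, -1:]))"
  by (simp add: p2_coeffs_def crit_def pcompose_pCons)

text \<open>Only k^2 enters, and k = 2 sqrt 3/5 * m gives k^2 = 12 m^2/25; hence the arguments 12
  m^2 and 25.\<close>

lemma p4_homogenized:
  "homogenize p4_coeffs [:0, 0, 12:] [:25:] 0 1
    = smult (2 ^ 38 * 5 ^ 34) (Poly val_coeffs * (Poly val_coeffs \<circ>\<^sub>p [:0, -1:]))"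
  by (simp add: p4_coeffs_def val_coeffs_def pcompose_pCons)

text \<open>The explicit cofactor certifies that \<open>crit\<close> divides the numerator obtained
  by substituting m = N/(2y).\<close>

lemma val_homogenized:
  "homogenize val_coeffs [:15, 1, -45, 33:] [:-2, 0, 6:] 0 1 = crit *
    [:178945779140442916232230450, -544556385415732371404411340, -6955428299508592189800470268,
    22390466768913619339889740956, 123888138556251570129524164608,
    -427527495793347527964919554468, -1332781330444405247447815166244,
    5024429292133269232150730349492, 9583777583290562692339629384822,
    -40600609333688245911221148443568, -47885292790300254542494408746480,
    238613409787414391061157835786736, 165137412322540931338662656763744,
    -1051712144356968220266529273061712, -359561826582036779017836191935440,
    3531212381146408870239835449585552, 271934712723124388213446419951732,
    -9074404115296540858065276859224168, 1193217351512977110187575771664248,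
    17756916533134391179021986816246216, -5348755122481497058951658991076512,
    -26038292667440235559533200351163384, 11557803703176401064949542281585544,
    27737671029565421062530066452412888, -15773800775053629418937324392963860,
    -20291644339139893818265266047409648, 13945145924100356767053235031784912,
    9137447275532834161794712167170352, -7625544238352964454014699368743392,
    -1920970367141330087908666222164624, 2448335050240870431740815328886768,
    -23892707847535105189241270409264, -665661454097736349490574422099718,
    55084295187279178934408489148372, 263519637945006128791847576720292,
    -15790676634673009557799983691140, -12294966125711925579585965824224,
    -6450328421081492254475714185860, -5247207054380682041619041813124,
    -7676948251975677666802243440876, -4691468376207358574156926547202:]"
  by (simp add: val_coeffs_def crit_def)

subsection \<open>Location of the roots\<close>

lemma poly_nonneg_coeffs_mono:
  fixes p :: "real poly"
  assumes "\<forall>c\<in>set (coeffs p). 0 \<le> c" "0 \<le> x" "x \<le> y"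
  shows "0 \<le> poly p x \<and> poly p x \<le> poly p y"
  using assms
proof (induction p)
  case 0
  then show ?case by simp
next
  case (pCons a p)
  then have "0 \<le> a" and IH: "0 \<le> poly p x" "poly p x \<le> poly p y"
    by (auto simp: cCons_def split: if_splits)
  moreover have "x * poly p x \<le> y * poly p y"
    using IH pCons.prems by (intro mult_mono) auto
  ultimately show ?case
    using pCons.prems by simp
qed

lemma crit_strict_mono:
  assumes "1 \<le> v" "v < w"
  shows "poly crit v < poly crit w"
proof -
  \<comment> \<open>The positive linear coefficient \<open>b\<close> is split off because it
    supplies the strictness; the tail \<open>p\<close> is only weakly monotone.\<close>
  obtain a b p where crit: "\<And>u. poly crit (1 + u) = poly (pCons a (pCons b p)) u"
    and b: "0 < b" and p: "\<forall>c\<in>set (coeffs p). 0 \<le> c"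
    by (rule that[OF crit_shift]) simp_all
  define s t where "s = v - 1" and "t = w - 1"
  have st: "0 \<le> s" "s < t" using assms by (auto simp: s_def t_def)
  have "0 \<le> poly p s" "poly p s \<le> poly p t"
    using poly_nonneg_coeffs_mono[OF p, of s t] st by auto
  then have "s * poly p s \<le> t * poly p t"
    using st by (intro mult_mono) auto
  moreover have "0 \<le> s * poly p s"
    using st \<open>0 \<le> poly p s\<close> by simp
  ultimately have "s * (b + s * poly p s) < t * (b + t * poly p t)"
    using st b by (intro mult_less_le_imp_less) auto
  then show ?thesis
    using crit[of s] crit[of t] by (simp add: s_def t_def)
qed

text \<open>The expansion is cut at its sign change: for u < 1/5 the positive part is at most 6 *
  10^9/5^8, far below the absolute value of the constant term.\<close>

lemma crit_neg_nonzero: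
  assumes "1 < v" "v < 6 / 5"
  shows "poly crit (- v) \<noteq> 0"
proof -
  define u where "u = v - 1"
  have u: "0 < u" "u < 1 / 5" using assms by (auto simp: u_def)
  define p :: "real poly" where "p = [:3242280960, 6477096960, 7282192896, 6333831936, 4571354880,
    2757509568, 1377914976, 562251456, 183235608, 46058220, 8424324, 1003833, 59049:]"
  have "poly p u \<le> poly p (1 / 5)"
    using poly_nonneg_coeffs_mono[of p u "1 / 5"] u by (simp add: p_def)
  also have "\<dots> < 6 * 10 ^ 9"
    by (simp add: p_def)
  finally have "u ^ 8 * poly p u \<le> (1 / 5) ^ 8 * (6 * 10 ^ 9)"
    using u by (intro mult_mono power_mono) (auto simp: p_def)
  then have "u ^ 8 * poly p u < 2621440"
    by (simp add: power_divide)
  moreover define q :: "real poly" where "q = [:2621440, 43253760, 310640640, 1271070720, 3244032000,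
    5255331840, 5023088640, 1522851840:]"
  have "poly q 0 \<le> poly q u"
    using poly_nonneg_coeffs_mono[of q 0 u] u by (simp add: q_def)
  then have "2621440 \<le> poly q u"
    by (simp add: q_def)
  moreover have "poly crit (- v) = u ^ 8 * poly p u - poly q u"
  proof -
    have "[:- 2621440, - 43253760, - 310640640, - 1271070720, - 3244032000, - 5255331840,
        - 5023088640, - 1522851840, 3242280960, 6477096960, 7282192896, 6333831936, 4571354880,
        2757509568, 1377914976, 562251456, 183235608, 46058220, 8424324, 1003833, 59049:]
      = monom 1 8 * p - q"
      by (simp add: p_def q_def monom_altdef power_numeral_reduce)
    moreover have "- v = - 1 - u" by (simp add: u_def)
    ultimately show ?thesis
      by (simp only: crit_neg_shift poly_diff poly_mult poly_monom mult_1)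
  qed
  ultimately show ?thesis
    by linarith
qed

text \<open>Each Horner step has the form c - x * y with 0 <= y <= d <= c, as in the Leibniz
  criterion.\<close>

lemma alternating_poly_bounds:
  fixes c :: real
  assumes "sorted_wrt (\<ge>) (c # cs)" "\<forall>d\<in>set (c # cs). 0 \<le> d" "0 \<le> x" "x \<le> 1"
  shows "0 \<le> poly (Poly (c # cs)) (- x) \<and> poly (Poly (c # cs)) (- x) \<le> c"
  using assms
proof (induction cs arbitrary: c)
  case Nil
  then show ?case by simp
next
  case (Cons d cs)
  define y where "y = poly (Poly (d # cs)) (- x)"
  have "0 \<le> y" "y \<le> d"
    using Cons.IH[of d] Cons.prems by (auto simp: y_def)
  moreover from this have "0 \<le> x * y" "x * y \<le> y"
    using Cons.prems by (auto intro: mult_left_le_one_le)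
  moreover have "d \<le> c" using Cons.prems by simp
  moreover have "poly (Poly (c # d # cs)) (- x) = c - x * y"
    by (simp add: y_def)
  ultimately show ?case by linarith
qed

text \<open>After the first two coefficients all signs are negative with decreasing size, so at -m
  the tail alternates and is at most c; the value stays positive since b + c < a.\<close>

lemma val_neg_nonzero:
  assumes "0 < m" "m < 1"
  shows "poly (Poly val_coeffs) (- m) \<noteq> 0"
proof -
  define a b c where "a = val_coeffs ! 0" and "b = val_coeffs ! 1" and "c = - (val_coeffs ! 2)"
  define cs where "cs = map uminus (drop 3 val_coeffs)"
  define y where "y = poly (Poly (c # cs)) (- m)"
  have abc: "0 < b" "0 < c" "b + c < a"
    by (simp_all add: a_def b_def c_def val_coeffs_def)
  have "0 \<le> y \<and> y \<le> c"
    unfolding y_def using assms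
    by (intro alternating_poly_bounds) (simp_all add: c_def cs_def val_coeffs_def)
  then have "m\<^sup>2 * y \<le> 1 * c"
    using assms by (intro mult_mono) (auto simp: power_le_one)
  moreover have "m * b \<le> 1 * b"
    using assms abc by (intro mult_right_mono) auto
  moreover have "poly (Poly val_coeffs) (- m) = a - m * b - m\<^sup>2 * y"
  proof -
    have val: "Poly val_coeffs = pCons a (pCons b (- Poly (c # cs)))"
      by (simp add: a_def b_def c_def cs_def val_coeffs_def)
    show ?thesis
      unfolding val y_def poly_pCons poly_minus by (simp only: power2_eq_square algebra_simps)
  qed
  ultimately show ?thesis
    using abc by linarith
qed

text \<open>This is Descartes' rule for one sign change: a root satisfies a/m^2 + b/m = p(m), where
  the left side strictly decreases and the right side does not.\<close>

lemma val_root_unique: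
  assumes "0 < m" "0 < n" "poly (Poly val_coeffs) m = 0" "poly (Poly val_coeffs) n = 0"
  shows "m = n"
proof -
  have *: False if "0 < m" "m < n" "poly (Poly val_coeffs) m = 0" "poly (Poly val_coeffs) n = 0"
    for m n
  proof -
    define a b p where "a = val_coeffs ! 0" and "b = val_coeffs ! 1"
      and "p = - Poly (drop 2 val_coeffs)"
    then have val: "Poly val_coeffs = pCons a (pCons b (- p))"
      and a: "0 < a" and b: "0 < b" and p: "\<forall>c\<in>set (coeffs p). 0 \<le> c"
      by (simp_all add: val_coeffs_def)
    have eq: "a + b * m = m\<^sup>2 * poly p m" "a + b * n = n\<^sup>2 * poly p n"
      using that(3,4) by (simp_all add: val power2_eq_square algebra_simps)
    have "poly p m \<le> poly p n"
      using poly_nonneg_coeffs_mono[OF p, of m n] that by auto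
    then have "m\<^sup>2 * n\<^sup>2 * poly p m \<le> m\<^sup>2 * n\<^sup>2 * poly p n"
      by (intro mult_left_mono) auto
    then have "(a + b * m) * n\<^sup>2 \<le> (a + b * n) * m\<^sup>2"
      using eq by (simp add: algebra_simps)
    moreover have "a * m\<^sup>2 < a * n\<^sup>2"
      using a that by (simp add: power_strict_mono)
    moreover have "b * m * n * m < b * m * n * n"
      using b that by simp
    ultimately show False
      by (simp add: power2_eq_square algebra_simps)
  qed
  show ?thesis
    using *[of m n] *[of n m] assms by (meson linorder_neqE_linordered_idom)
qed

section \<open>From the roots of \<open>p2\<close> and \<open>p4\<close> to the critical point and
  its value\<close>

lemma quad_pos: "1 \<le> v \<Longrightarrow> 0 < 3 * v\<^sup>2 - (1::real)"
  using one_le_power[of v 2] by linarith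

lemma cubic_pos: "1 \<le> v \<Longrightarrow> 0 < 33 * v ^ 3 - 45 * v\<^sup>2 + v + (15::real)"
proof -
  assume "1 \<le> v"
  then have "33 * v ^ 3 - 45 * v\<^sup>2 + v + 15 = 33 * (v - 1) ^ 3 + 54 * (v - 1)\<^sup>2 + 10 * (v - 1) + 4"
    by (simp add: power2_eq_square power3_eq_cube algebra_simps)
  also have "\<dots> > 0"
    using \<open>1 \<le> v\<close> by (intro add_nonneg_pos add_nonneg_nonneg mult_nonneg_nonneg zero_le_power) auto
  finally show ?thesis .
qed

lemma p2_root_imp_crit_root:
  assumes "1 < v" "v < 6 / 5" "p2 ((3 * v\<^sup>2 - 1) / (3 * v\<^sup>2 + 1)) = 0"
  shows "poly crit v = 0"
proof -
  have f: "poly [:-1, 0, 3:] v = 3 * v\<^sup>2 - 1" and g: "poly [:1, 0, 3:] v = 3 * v\<^sup>2 + 1"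
    by (simp_all add: power2_eq_square)
  have "3 * v\<^sup>2 + 1 > 0" by (simp add: add_nonneg_pos)
  then have "poly (homogenize p2_coeffs [:-1, 0, 3:] [:1, 0, 3:] 0 1) v = 0"
    using assms(3) poly_homogenize_eq_0_iff[of "[:1, 0, 3:]" v p2_coeffs "[:-1, 0, 3:]"]
    unfolding f g p2_eq_poly by simp
  then have "poly crit v * poly crit (- v) = 0"
    unfolding p2_homogenized by (simp add: poly_pcompose)
  with crit_neg_nonzero[OF assms(1,2)] show ?thesis
    by simp
qed

lemma p4_root_imp_val_root:
  assumes "0 < m" "m < 1" "p4 (2 * sqrt 3 / 5 * m) = 0"
  shows "poly (Poly val_coeffs) m = 0"
proof -
  have sq: "(2 * sqrt 3 / 5 * m)\<^sup>2 = 12 * m\<^sup>2 / 25"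
    by (simp add: power_mult_distrib power_divide)
  have "poly (homogenize p4_coeffs [:0, 0, 12:] [:25:] 0 1) m = 0"
    using assms(3) unfolding p4_eq_poly sq
    by (subst poly_homogenize_eq_0_iff) (auto simp: power2_eq_square algebra_simps)
  then have "poly (Poly val_coeffs) m * poly (Poly val_coeffs) (- m) = 0"
    unfolding p4_homogenized by (simp add: poly_pcompose)
  with val_neg_nonzero[OF assms(1,2)] show ?thesis
    by simp
qed

lemma crit_root_imp_val_root:
  assumes "1 < v" "poly crit v = 0"
  shows "poly (Poly val_coeffs) ((33 * v ^ 3 - 45 * v\<^sup>2 + v + 15) / (2 * (3 * v\<^sup>2 - 1))) = 0"
proof -
  have v: "3 * v\<^sup>2 - 1 > 0" using assms by (intro quad_pos) simp
  have n: "poly [:15, 1, -45, 33:] v = 33 * v ^ 3 - 45 * v\<^sup>2 + v + 15"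
    and d: "poly [:-2, 0, 6:] v = 2 * (3 * v\<^sup>2 - 1)"
    by (simp_all add: power2_eq_square power3_eq_cube algebra_simps)
  have "poly (homogenize val_coeffs [:15, 1, -45, 33:] [:-2, 0, 6:] 0 1) v = 0"
    by (simp only: val_homogenized poly_mult assms(2) mult_zero_left)
  with poly_homogenize_eq_0_iff[of "[:-2, 0, 6:]" v val_coeffs "[:15, 1, -45, 33:]"] v show ?thesis
    unfolding n d by simp
qed

text \<open>The rescaled \<open>k0\<close> and N/(2y) are both positive roots of the polynomial with
  coefficients \<open>val_coeffs\<close>, hence equal.\<close>

lemma k0_eq_critical_value:
  assumes "1 / 2 < k0" "k0 < 9 / 13" "p4 k0 = 0" "1 < v" "poly crit v = 0"
  shows "k0 = sqrt 3 * ((33 * v ^ 3 - 45 * v\<^sup>2 + v + 15) / (5 * (3 * v\<^sup>2 - 1)))"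
proof -
  define m where "m = 5 * k0 / (2 * sqrt 3)"
  have k0: "k0 = 2 * sqrt 3 / 5 * m" by (simp add: m_def)
  \<comment> \<open>Needed for m < 1, that is k0 < 2 sqrt 3/5, because 9/13 = 2/5 * 45/26.\<close>
  have "45 / 26 < sqrt 3"
    by (rule real_less_rsqrt) (simp add: power2_eq_square)
  then have m: "0 < m" "m < 1"
    using assms(1,2) by (auto simp: m_def field_simps)
  have y: "3 * v\<^sup>2 - 1 > 0" using assms by (intro quad_pos) simp
  have "poly (Poly val_coeffs) m = 0"
    using p4_root_imp_val_root[OF m] assms(3) k0 by metis
  moreover have "0 < (33 * v ^ 3 - 45 * v\<^sup>2 + v + 15) / (2 * (3 * v\<^sup>2 - 1))"
    using y cubic_pos[of v] assms(4) by simp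
  ultimately have "m = (33 * v ^ 3 - 45 * v\<^sup>2 + v + 15) / (2 * (3 * v\<^sup>2 - 1))"
    using m crit_root_imp_val_root[OF assms(4,5)] val_root_unique by blast
  moreover have "2 * s / 5 * (n / (2 * y)) = s * (n / (5 * y))" for s n y :: real
    by simp
  ultimately show ?thesis
    unfolding k0 by metis
qed

subsection \<open>The one-variable minimum\<close>

text \<open>
  For the isosceles triangle whose tangent lengths \<open>p - a\<close>, \<open>p - b\<close>, \<open>p - c\<close> are in the ratio
  \<open>2 : 3v\<^sup>2 - 1 : 3v\<^sup>2 - 1\<close>, the following are \<open>2r/R\<close> and \<open>p/(sqrt 3 r) - 3\<close>.
\<close>

definition ratio :: "real \<Rightarrow> real" where
  "ratio v = 8 * (3 * v\<^sup>2 - 1) / (3 * v\<^sup>2 + 1)\<^sup>2"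

definition excess :: "real \<Rightarrow> real" where
  "excess v = 3 * (v - 1)\<^sup>2 * (2 * v + 1) / (3 * v\<^sup>2 - 1)"

lemma one_minus_ratio: "1 - ratio v = 9 * (v\<^sup>2 - 1)\<^sup>2 / (3 * v\<^sup>2 + 1)\<^sup>2"
proof -
  have "3 * v\<^sup>2 + 1 \<noteq> 0" using zero_le_power2[of v] by linarith
  then show ?thesis
    unfolding ratio_def by (simp add: divide_simps) algebra
qed

lemma ratio_bounds:
  assumes "1 < v"
  shows "0 < ratio v" "ratio v < 1"
proof -
  have "v\<^sup>2 > 1" using assms by (simp add: one_less_power)
  then have "0 < 9 * (v\<^sup>2 - 1)\<^sup>2 / (3 * v\<^sup>2 + 1)\<^sup>2" by simp
  then show "ratio v < 1" using one_minus_ratio[of v] by linarith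
  show "0 < ratio v" using quad_pos[of v] assms by (simp add: ratio_def add_nonneg_pos)
qed

lemma excess_has_derivative:
  assumes "1 < v"
  shows "(excess has_real_derivative 18 * v\<^sup>2 * (v\<^sup>2 - 1) / (3 * v\<^sup>2 - 1)\<^sup>2) (at v)"
proof -
  have y: "3 * v\<^sup>2 - 1 \<noteq> 0" using quad_pos[of v] assms by simp
  show ?thesis
    unfolding excess_def
    apply (rule derivative_eq_intros refl y)+
    using y by (simp add: divide_simps) algebra
qed

lemma ratio_has_derivative:
  "(ratio has_real_derivative 144 * v * (1 - v\<^sup>2) / (3 * v\<^sup>2 + 1) ^ 3) (at v)"
proof -
  have z: "3 * v\<^sup>2 + 1 \<noteq> 0" using zero_le_power2[of v] by linarith
  then have z2: "(3 * v\<^sup>2 + 1)\<^sup>2 \<noteq> 0" by simp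
  show ?thesis
    unfolding ratio_def
    apply (rule derivative_eq_intros refl z2)+
    using z by (simp add: divide_simps) algebra
qed

text \<open>For v > 1 this is the largest k / sqrt 3 for which the inequality holds at the isosceles
  triangle with parameter v.\<close>

definition bound :: "real \<Rightarrow> real" where
  "bound v = excess v / (1 - ratio v ^ 5)"

lemma bound_has_derivative:
  assumes "1 < v"
  shows "(bound has_real_derivative
    54 * v * (v\<^sup>2 - 1) * (v - 1) ^ 3 * poly crit v /
      ((3 * v\<^sup>2 - 1)\<^sup>2 * (3 * v\<^sup>2 + 1) ^ 11 * (1 - ratio v ^ 5)\<^sup>2)) (at v)"
proof -
  define y z x n where "y = 3 * v\<^sup>2 - 1" and "z = 3 * v\<^sup>2 + 1" and "x = ratio v"
    and "n = 33 * v ^ 3 - 45 * v\<^sup>2 + v + 15"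
  define G G' x' where "G = excess v" and "G' = 18 * v\<^sup>2 * (v\<^sup>2 - 1) / y\<^sup>2"
    and "x' = 144 * v * (1 - v\<^sup>2) / z ^ 3"
  have y: "y > 0" using quad_pos[of v] assms by (simp add: y_def)
  then have z: "z > 0" by (simp add: y_def z_def)
  have x: "x = 8 * y / z\<^sup>2" by (simp add: x_def ratio_def y_def z_def)
  have G: "G = 3 * (v - 1)\<^sup>2 * (2 * v + 1) / y" by (simp add: G_def excess_def y_def)
  have "x ^ 5 < 1" using ratio_bounds[OF assms] by (simp add: x_def power_less_one_iff)
  then have D: "1 - x ^ 5 \<noteq> 0" by simp
  \<comment> \<open>L is -G'/(5x'). Multiplying the numerator of the derivative by L makes G' a
    factor and leaves L - x^4 (x L + G).\<close>
  define L where "L = v * z ^ 3 / (40 * y\<^sup>2)"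
  have "L \<noteq> 0" using y z assms by (simp add: L_def)
  have L: "5 * x' * L = - G'"
    using y z by (simp add: L_def x'_def G'_def divide_simps) algebra
  \<comment> \<open>The cubic arises here: where L = x^4 (x L + G), the quotient G/(1 - x^5) equals
    x L + G.\<close>
  have H: "x * L + G = n / (5 * y)"
  proof -
    have "x * L = v * z / (5 * y)"
      using y z unfolding L_def x by (simp add: divide_simps) algebra
    then show ?thesis
      using y unfolding G by (simp add: divide_simps n_def z_def) algebra
  qed
  have "L - x ^ 4 * (x * L + G) = (v * z ^ 11 - 8 ^ 5 * n * y ^ 5) / (40 * y\<^sup>2 * z ^ 8)"
    using y z unfolding H unfolding L_def x by (simp add: divide_simps) algebra
  also have "v * z ^ 11 - 8 ^ 5 * n * y ^ 5 = 3 * (v - 1) ^ 3 * poly crit v"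
    using crit_factorization[of v] by (simp add: y_def z_def n_def)
  finally have C: "L - x ^ 4 * (x * L + G) = 3 * (v - 1) ^ 3 * poly crit v / (40 * y\<^sup>2 * z ^ 8)" .
  have "L * (G' * (1 - x ^ 5) + 5 * x ^ 4 * x' * G) = G' * (L - x ^ 4 * (x * L + G))"
    using L by algebra
  also have "\<dots> = L * (54 * v * (v\<^sup>2 - 1) * (v - 1) ^ 3 * poly crit v / (y\<^sup>2 * z ^ 11))"
    using y z unfolding C unfolding L_def G'_def by (simp add: divide_simps) algebra
  finally have num: "G' * (1 - x ^ 5) + 5 * x ^ 4 * x' * G
      = 54 * v * (v\<^sup>2 - 1) * (v - 1) ^ 3 * poly crit v / (y\<^sup>2 * z ^ 11)"
    by (simp only: mult_left_cancel[OF \<open>L \<noteq> 0\<close>])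
  have dG: "(excess has_real_derivative G') (at v)"
    using excess_has_derivative[OF assms] by (simp only: G'_def y_def)
  have dx: "(ratio has_real_derivative x') (at v)"
    using ratio_has_derivative[of v] by (simp only: x'_def z_def)
  have "((\<lambda>w. 1 - ratio w ^ 5) has_real_derivative 0 - of_nat 5 * (x' * ratio v ^ (5 - Suc 0))) (at v)"
    by (intro DERIV_diff DERIV_const DERIV_power dx)
  then have "((\<lambda>w. 1 - ratio w ^ 5) has_real_derivative - (5 * x ^ 4 * x')) (at v)"
    by (simp add: x_def mult_ac)
  from DERIV_divide[OF dG this] D
  have "(bound has_real_derivative
      (G' * (1 - x ^ 5) - G * (- (5 * x ^ 4 * x'))) / ((1 - x ^ 5) * (1 - x ^ 5))) (at v)"
    unfolding bound_def[abs_def] G_def x_def by blast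
  moreover have "G' * (1 - x ^ 5) - G * (- (5 * x ^ 4 * x'))
      = 54 * v * (v\<^sup>2 - 1) * (v - 1) ^ 3 * poly crit v / (y\<^sup>2 * z ^ 11)"
    using num by (simp only: mult_minus_right diff_minus_eq_add) (simp only: ac_simps)
  ultimately show ?thesis
    unfolding x_def[symmetric] y_def[symmetric] z_def[symmetric] by (simp add: power2_eq_square)
qed

lemma bound_derivative_sgn:
  assumes "1 < v"
  shows "\<exists>d. (bound has_real_derivative d) (at v) \<and> sgn d = sgn (poly crit v)"
proof -
  have v2: "v\<^sup>2 > 1" using assms by (simp add: one_less_power)
  then have a: "54 * v * (v\<^sup>2 - 1) * (v - 1) ^ 3 > 0" using assms by simp
  have "ratio v ^ 5 < 1" using ratio_bounds[OF assms] by (simp add: power_less_one_iff)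
  then have b: "(3 * v\<^sup>2 - 1)\<^sup>2 * (3 * v\<^sup>2 + 1) ^ 11 * (1 - ratio v ^ 5)\<^sup>2 > 0"
    using v2 by simp
  have "sgn (A * p / B) = sgn p" if "A > 0" "B > 0" for A p B :: real
    using that by (simp add: sgn_mult sgn_divide)
  from bound_has_derivative[OF assms] this[OF a b] show ?thesis
    by blast
qed

lemma bound_minimum:
  assumes "1 < v" "1 < c" "poly crit c = 0" "v \<noteq> c"
  shows "bound c < bound v"
proof -
  have cont: "continuous_on {a..b} bound" if "1 < a" for a b
    using that by (intro continuous_at_imp_continuous_on ballI)
      (auto intro: DERIV_isCont[OF bound_has_derivative])
  show ?thesis
  proof (cases "v < c")
    case True
    show ?thesis
    proof (rule DERIV_neg_imp_decreasing_open[OF True])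
      fix w assume w: "v < w" "w < c"
      then have "poly crit w < 0" using crit_strict_mono[of w c] assms by simp
      then show "\<exists>d. (bound has_real_derivative d) (at w) \<and> d < 0"
        using bound_derivative_sgn[of w] w assms by (auto simp: sgn_if split: if_splits)
    qed (use cont assms in auto)
  next
    case False
    with assms have "c < v" by simp
    then show ?thesis
    proof (rule DERIV_pos_imp_increasing_open)
      fix w assume w: "c < w" "w < v"
      then have "poly crit w > 0" using crit_strict_mono[of c w] assms by simp
      then show "\<exists>d. (bound has_real_derivative d) (at w) \<and> d > 0"
        using bound_derivative_sgn[of w] w assms by (auto simp: sgn_if split: if_splits)
    qed (use cont assms in auto)
  qed
qed

lemma bound_at_critical:
  assumes "1 < v" "poly crit v = 0"
  shows "bound v = (33 * v ^ 3 - 45 * v\<^sup>2 + v + 15) / (5 * (3 * v\<^sup>2 - 1))"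
proof -
  define y z n where "y = 3 * v\<^sup>2 - 1" and "z = 3 * v\<^sup>2 + 1"
    and "n = 33 * v ^ 3 - 45 * v\<^sup>2 + v + 15"
  have y: "y > 0" using quad_pos[of v] assms by (simp add: y_def)
  then have z: "z > 0" by (simp add: y_def z_def)
  have n: "n > 0" using cubic_pos[of v] assms by (simp add: n_def)
  have x: "ratio v = 8 * y / z\<^sup>2" by (simp add: ratio_def y_def z_def)
  \<comment> \<open>At a root of \<open>crit\<close> this reads n x^5 = v z, and n - v z = 15 (v -
    1)^2 (2v + 1), which is 5 y times \<open>excess v\<close>.\<close>
  have "v * z ^ 11 = 8 ^ 5 * n * y ^ 5"
    using crit_factorization[of v] assms by (simp add: y_def z_def n_def)
  then have "n * ratio v ^ 5 = v * z"
    using z unfolding x by (simp add: divide_simps) algebra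
  then have "n * (1 - ratio v ^ 5) = 5 * y * excess v"
    using y unfolding excess_def y_def[symmetric] by (simp add: n_def z_def) algebra
  moreover have "ratio v ^ 5 < 1" using ratio_bounds[of v] assms by (simp add: power_less_one_iff)
  ultimately show ?thesis
    using y unfolding bound_def y_def[symmetric] n_def[symmetric]
    by (simp add: divide_simps)
qed

lemma ratio_surj:
  assumes "0 < x" "x \<le> 1"
  obtains v where "1 \<le> v" "ratio v = x"
proof -
  \<comment> \<open>By \<open>one_minus_ratio\<close>, s should be 3(v^2 - 1)/(3v^2 + 1); solving
    for v^2 gives the witness below.\<close>
  define s where "s = sqrt (1 - x)"
  have s: "0 \<le> s" "s < 1" "s\<^sup>2 = 1 - x" using assms by (auto simp: s_def)
  define v where "v = sqrt ((3 + s) / (3 * (1 - s)))"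
  have v2: "v\<^sup>2 = (3 + s) / (3 * (1 - s))" using s by (simp add: v_def)
  have "1 \<le> v" using s by (simp add: v_def divide_simps)
  moreover have "ratio v = x"
  proof -
    have "3 * v\<^sup>2 - 1 = 2 * (1 + s) / (1 - s)" "3 * v\<^sup>2 + 1 = 4 / (1 - s)"
      using s unfolding v2 by (simp_all add: field_simps)
    then have "ratio v = 1 - s\<^sup>2"
      using s unfolding ratio_def by (simp add: divide_simps) algebra
    then show ?thesis using s by simp
  qed
  ultimately show ?thesis using that by blast
qed

subsection \<open>Reduction to isosceles triangles\<close>

text \<open>Blundon's inequality in tangent lengths: \<open>ratio\<close> fixes k = s q/e, and the
  discriminant then confines w = s^3/e = (p/r)^2 between two roots w1 <= w2. Equality makes the
  discriminant vanish, so two lengths agree.\<close>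

lemma blundon_lower:
  fixes X Y Z v :: real
  assumes pos: "0 < X" "0 < Y" "0 < Z" and v: "1 \<le> v"
    and ratio: "8 * X * Y * Z / ((X + Y) * (Y + Z) * (Z + X)) = ratio v"
  shows "108 * v ^ 6 / (3 * v\<^sup>2 - 1)\<^sup>2 \<le> (X + Y + Z) ^ 3 / (X * Y * Z)"
    and "108 * v ^ 6 / (3 * v\<^sup>2 - 1)\<^sup>2 = (X + Y + Z) ^ 3 / (X * Y * Z) \<Longrightarrow> X = Y \<or> Y = Z \<or> Z = X"
proof -
  \<comment> \<open>These are the values of w at the tangent lengths 2 : y : y and y : 2 : 2, the
    two isosceles shapes sharing this ratio.\<close>
  define y w1 w2 where "y = 3 * v\<^sup>2 - 1" and "w1 = 108 * v ^ 6 / (3 * v\<^sup>2 - 1)\<^sup>2"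
    and "w2 = 27 * (v\<^sup>2 + 1) ^ 3 / (4 * (3 * v\<^sup>2 - 1))"
  define s q e w k where "s = X + Y + Z" and "q = X * Y + Y * Z + Z * X" and "e = X * Y * Z"
    and "w = s ^ 3 / e" and "k = s * q / e"
  have y: "0 < y" using quad_pos[OF v] by (simp add: y_def)
  have e: "0 < e" and s: "0 < s" using pos by (auto simp: e_def s_def)
  have "(X + Y) * (Y + Z) * (Z + X) = s * q - e"
    unfolding s_def q_def e_def by algebra
  moreover have "0 < (X + Y) * (Y + Z) * (Z + X)" using pos by simp
  ultimately have "8 * e / (s * q - e) = 8 * y / (y + 2)\<^sup>2" "0 < s * q - e"
    using ratio by (simp_all add: e_def ratio_def y_def mult.assoc)
  then have "e * (y + 2)\<^sup>2 = y * (s * q - e)"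
    using y by (simp add: divide_simps)
  then have "k = 1 + (y + 2)\<^sup>2 / y"
    using y e by (simp add: k_def divide_simps) algebra
  also have "\<dots> = (y + (y + 2)\<^sup>2) / y"
    using y by (simp add: divide_simps)
  also have "y + (y + 2)\<^sup>2 = 9 * v\<^sup>2 * (v\<^sup>2 + 1)"
    unfolding y_def by algebra
  finally have k: "k = 9 * v\<^sup>2 * (v\<^sup>2 + 1) / y" .
  have w12: "w1 + w2 = (k\<^sup>2 + 18 * k - 27) / 4" "w1 * w2 = k ^ 3"
    using y unfolding k w1_def w2_def y_def[symmetric]
    by (simp_all add: divide_simps) (simp add: y_def, algebra)+
  have "w2 - w1 = 27 * (v\<^sup>2 - 1) ^ 3 * (3 * v\<^sup>2 + 1) / (4 * y\<^sup>2)"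
    using y unfolding w1_def w2_def y_def[symmetric]
    by (simp add: divide_simps) (simp add: y_def, algebra)
  also have "\<dots> \<ge> 0" using v by simp
  finally have le: "w1 \<le> w2" by simp
  txt \<open>The discriminant of the cubic with roots \<open>X\<close>, \<open>Y\<close>, \<open>Z\<close> is nonnegative.\<close>
  have "(w - w1) * (w - w2) = w\<^sup>2 - (w1 + w2) * w + w1 * w2"
    by algebra
  also have "\<dots> = - (s ^ 3 * ((X - Y) * (Y - Z) * (Z - X))\<^sup>2 / (4 * e ^ 3))"
  proof -
    have d: "((X - Y) * (Y - Z) * (Z - X))\<^sup>2
        = s\<^sup>2 * q\<^sup>2 - 4 * q ^ 3 - 4 * s ^ 3 * e + 18 * s * q * e - 27 * e\<^sup>2"
      unfolding s_def q_def e_def by algebra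
    show ?thesis
      using e unfolding d w12 w_def k_def by (simp add: divide_simps) algebra
  qed
  finally have disc: "(w - w1) * (w - w2)
    = - (s ^ 3 * ((X - Y) * (Y - Z) * (Z - X))\<^sup>2 / (4 * e ^ 3))" .
  have "(w - w1) * (w - w2) \<le> 0"
    unfolding disc using s e by simp
  then have "w1 \<le> w"
    using le mult_neg_neg[of "w - w1" "w - w2"] by (cases "w1 \<le> w") auto
  then show "108 * v ^ 6 / (3 * v\<^sup>2 - 1)\<^sup>2 \<le> (X + Y + Z) ^ 3 / (X * Y * Z)"
    by (simp add: w1_def w_def s_def e_def)
  show "X = Y \<or> Y = Z \<or> Z = X" if "108 * v ^ 6 / (3 * v\<^sup>2 - 1)\<^sup>2 = (X + Y + Z) ^ 3 / (X * Y * Z)"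
  proof -
    have "w = w1" using that by (simp add: w1_def w_def s_def e_def)
    then show ?thesis using disc s e by auto
  qed
qed

text \<open>The ratio alone allows 2Y = yX or yY = 2X. The second shape has w = w2, which differs
  from w1 when v > 1.\<close>

lemma isosceles_iff:
  fixes X Y v :: real
  assumes pos: "0 < X" "0 < Y" and v: "1 < v"
  shows "8 * X * Y * Y / ((X + Y) * (Y + Y) * (Y + X)) = ratio v \<and>
      108 * v ^ 6 / (3 * v\<^sup>2 - 1)\<^sup>2 = (X + Y + Y) ^ 3 / (X * Y * Y) \<longleftrightarrow>
    2 * Y = (3 * v\<^sup>2 - 1) * X"
    (is "?ratio \<and> ?w \<longleftrightarrow> _")
proof -
  define y where "y = 3 * v\<^sup>2 - 1"
  have y: "0 < y" using quad_pos[of v] v by (simp add: y_def)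
  have "?ratio \<longleftrightarrow> X * Y * (y + 2)\<^sup>2 = 2 * y * (X + Y)\<^sup>2"
  proof -
    have "8 * X * Y * Y / ((X + Y) * (Y + Y) * (Y + X)) = 4 * X * Y / (X + Y)\<^sup>2"
      using pos by (simp add: divide_simps) algebra
    moreover have "ratio v = 8 * y / (y + 2)\<^sup>2"
      by (simp add: ratio_def y_def)
    moreover have "4 * X * Y / (X + Y)\<^sup>2 = 8 * y / (y + 2)\<^sup>2 \<longleftrightarrow>
        4 * X * Y * (y + 2)\<^sup>2 = 8 * y * (X + Y)\<^sup>2"
      using pos y by (intro frac_eq_eq) auto
    ultimately show ?thesis
      by auto
  qed
  also have "\<dots> \<longleftrightarrow> (2 * Y - y * X) * (y * Y - 2 * X) = 0"
    by (simp only: power2_eq_square) algebra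
  finally have ratio_iff: "?ratio \<longleftrightarrow> 2 * Y = y * X \<or> y * Y = 2 * X"
    by simp
  have w1: ?w if "2 * Y = y * X"
  proof -
    have Y: "Y = y * X / 2" using that by simp
    show ?thesis
      unfolding y_def[symmetric] unfolding Y using y pos
      by (simp add: divide_simps) (simp add: y_def, algebra)
  qed
  have w2: False if "?w" "y * Y = 2 * X"
  proof -
    have X: "X = y * Y / 2" using that by simp
    have "(X + Y + Y) ^ 3 / (X * Y * Y) = 27 * (v\<^sup>2 + 1) ^ 3 / (4 * y)"
      unfolding X using y pos by (simp add: divide_simps) (simp add: y_def, algebra)
    with that have "108 * v ^ 6 * (4 * y) = 27 * (v\<^sup>2 + 1) ^ 3 * y\<^sup>2"
      using y unfolding y_def[symmetric] by (simp add: frac_eq_eq)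
    then have "16 * v ^ 6 = (v\<^sup>2 + 1) ^ 3 * y"
      using y by (simp add: power2_eq_square)
    then have "(v\<^sup>2 - 1) ^ 3 * (3 * v\<^sup>2 + 1) = 0"
      unfolding y_def by algebra
    moreover have "v\<^sup>2 > 1" using v by (simp add: one_less_power)
    ultimately show False by simp
  qed
  show ?thesis
    using ratio_iff w1 w2 unfolding y_def by blast
qed

section \<open>The inequality and its equality case in tangent lengths\<close>

lemma sqrt_extremal:
  assumes "1 \<le> v"
  shows "sqrt (108 * v ^ 6 / (3 * v\<^sup>2 - 1)\<^sup>2) = 3 * sqrt 3 + sqrt 3 * excess v"
proof -
  define y where "y = 3 * v\<^sup>2 - 1"
  have y: "0 < y" using quad_pos[OF assms] by (simp add: y_def)
  have "108 * v ^ 6 / y\<^sup>2 = 3 * (6 * v ^ 3 / y)\<^sup>2"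
    using y by (simp add: power_divide power_mult_distrib flip: power_mult)
  then have "sqrt (108 * v ^ 6 / y\<^sup>2) = sqrt 3 * (6 * v ^ 3 / y)"
    using y assms by (simp add: real_sqrt_mult)
  also have "6 * v ^ 3 / y = 3 + excess v"
    using y unfolding excess_def y_def[symmetric] by (simp add: divide_simps) (simp add: y_def, algebra)
  finally show ?thesis
    by (simp add: y_def algebra_simps)
qed

lemma excess_eq_bound:
  assumes "1 < v"
  shows "excess v = bound v * (1 - ratio v ^ 5)" "0 < 1 - ratio v ^ 5"
proof -
  show "0 < 1 - ratio v ^ 5" using ratio_bounds[OF assms] by (simp add: power_less_one_iff)
  then show "excess v = bound v * (1 - ratio v ^ 5)" by (simp add: bound_def)
qed

text \<open>Euler's inequality R >= 2r: the denominator exceeds the numerator by a positively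
  weighted sum of squared differences.\<close>

lemma prod_pair_sums_bound:
  fixes X Y Z :: real
  assumes "0 < X" "0 < Y" "0 < Z"
  shows "8 * X * Y * Z / ((X + Y) * (Y + Z) * (Z + X)) \<le> 1"
    and "8 * X * Y * Z / ((X + Y) * (Y + Z) * (Z + X)) = 1 \<longleftrightarrow> X = Y \<and> Y = Z"
proof -
  define d where "d = X * (Y - Z)\<^sup>2 + Y * (Z - X)\<^sup>2 + Z * (X - Y)\<^sup>2"
  have eq: "(X + Y) * (Y + Z) * (Z + X) = 8 * X * Y * Z + d"
    unfolding d_def by algebra
  have nn: "0 \<le> X * (Y - Z)\<^sup>2" "0 \<le> Y * (Z - X)\<^sup>2" "0 \<le> Z * (X - Y)\<^sup>2"
    using assms by auto
  then have "0 \<le> d" by (simp add: d_def)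
  moreover have "0 < 8 * X * Y * Z" using assms by simp
  ultimately show "8 * X * Y * Z / ((X + Y) * (Y + Z) * (Z + X)) \<le> 1"
    unfolding eq by simp
  have "8 * X * Y * Z / ((X + Y) * (Y + Z) * (Z + X)) = 1 \<longleftrightarrow> d = 0"
    using \<open>0 \<le> d\<close> \<open>0 < 8 * X * Y * Z\<close> unfolding eq by (simp add: divide_eq_1_iff)
  also have "\<dots> \<longleftrightarrow> X = Y \<and> Y = Z"
    using nn assms unfolding d_def by (auto simp: add_nonneg_eq_0_iff)
  finally show "8 * X * Y * Z / ((X + Y) * (Y + Z) * (Z + X)) = 1 \<longleftrightarrow> X = Y \<and> Y = Z" .
qed

text \<open>Three estimates are chained: Blundon's bound, the minimality of \<open>bound c\<close>,
  and the hypothesis on k. Equality forces all three to be equalities. The case v = 1 is separate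
  since \<open>bound\<close> is 0/0 there.\<close>

lemma tangent_length_inequality:
  fixes X Y Z k c :: real
  assumes pos: "0 < X" "0 < Y" "0 < Z"
    and c: "1 < c" "poly crit c = 0" and k: "k \<le> sqrt 3 * bound c"
  defines "x \<equiv> 8 * X * Y * Z / ((X + Y) * (Y + Z) * (Z + X))"
    and "w \<equiv> (X + Y + Z) ^ 3 / (X * Y * Z)"
  shows "3 * sqrt 3 + k * (1 - x ^ 5) \<le> sqrt w"
    and "sqrt w = 3 * sqrt 3 + k * (1 - x ^ 5) \<longleftrightarrow>
      X = Y \<and> Y = Z \<or> k = sqrt 3 * bound c \<and> x = ratio c \<and> 108 * c ^ 6 / (3 * c\<^sup>2 - 1)\<^sup>2 = w"
proof -
  have "0 < x" using pos by (simp add: x_def)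
  moreover have "x \<le> 1" using prod_pair_sums_bound(1)[OF pos] by (simp add: x_def)
  ultimately obtain v where v: "1 \<le> v" "ratio v = x"
    using ratio_surj by blast
  have x1: "x = 1 \<longleftrightarrow> X = Y \<and> Y = Z"
    using prod_pair_sums_bound(2)[OF pos] by (simp add: x_def)
  have lower: "108 * v ^ 6 / (3 * v\<^sup>2 - 1)\<^sup>2 \<le> w"
    using blundon_lower(1)[OF pos v(1)] v(2) by (simp add: x_def w_def)
  have "3 * sqrt 3 + k * (1 - x ^ 5) \<le> sqrt w \<and>
    (sqrt w = 3 * sqrt 3 + k * (1 - x ^ 5) \<longleftrightarrow>
      X = Y \<and> Y = Z \<or> k = sqrt 3 * bound c \<and> x = ratio c \<and> 108 * c ^ 6 / (3 * c\<^sup>2 - 1)\<^sup>2 = w)"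
  proof (cases "v = 1")
    case True
    with v have "x = 1" by (simp add: ratio_def)
    with x1 have "X = Y" "Y = Z" by auto
    then have "w = 27" using pos by (simp add: w_def power3_eq_cube)
    moreover have "sqrt 27 = 3 * sqrt 3"
      using real_sqrt_mult[of 9 3] by simp
    ultimately show ?thesis
      using \<open>x = 1\<close> \<open>X = Y\<close> \<open>Y = Z\<close> by simp
  next
    case False
    with v have v1: "1 < v" by simp
    have x: "x < 1" "0 < 1 - x ^ 5"
      using ratio_bounds[OF v1] excess_eq_bound[OF v1] v by auto
    have root: "sqrt (108 * v ^ 6 / (3 * v\<^sup>2 - 1)\<^sup>2) = 3 * sqrt 3 + sqrt 3 * bound v * (1 - x ^ 5)"
      using sqrt_extremal[OF v(1)] excess_eq_bound[OF v1] v(2) by simp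
    have s1: "3 * sqrt 3 + sqrt 3 * bound v * (1 - x ^ 5) \<le> sqrt w"
      unfolding root[symmetric] using lower by simp
    have s2: "sqrt 3 * bound c * (1 - x ^ 5) \<le> sqrt 3 * bound v * (1 - x ^ 5)"
      using bound_minimum[OF v1 c] x by (cases "v = c") (auto intro!: mult_right_mono)
    have s3: "k * (1 - x ^ 5) \<le> sqrt 3 * bound c * (1 - x ^ 5)"
      using k x by (intro mult_right_mono) auto
    have "k = sqrt 3 * bound c \<and> x = ratio c \<and> 108 * c ^ 6 / (3 * c\<^sup>2 - 1)\<^sup>2 = w"
      if eq: "sqrt w = 3 * sqrt 3 + k * (1 - x ^ 5)"
    proof -
      have "sqrt 3 * bound c * (1 - x ^ 5) = sqrt 3 * bound v * (1 - x ^ 5)"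
        "k * (1 - x ^ 5) = sqrt 3 * bound c * (1 - x ^ 5)"
        "sqrt w = sqrt (108 * v ^ 6 / (3 * v\<^sup>2 - 1)\<^sup>2)"
        using s1 s2 s3 eq root by linarith+
      then have "bound c = bound v" "k = sqrt 3 * bound c" "w = 108 * v ^ 6 / (3 * v\<^sup>2 - 1)\<^sup>2"
        using x by (simp_all only: real_sqrt_eq_iff) auto
      moreover from this have "v = c" using bound_minimum[OF v1 c] by auto
      ultimately show ?thesis using v by simp
    qed
    moreover have "sqrt w = 3 * sqrt 3 + k * (1 - x ^ 5)"
      if "k = sqrt 3 * bound c" "x = ratio c" "108 * c ^ 6 / (3 * c\<^sup>2 - 1)\<^sup>2 = w"
      using sqrt_extremal[of c] excess_eq_bound[OF c(1)] c(1) that by simp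
    moreover have "\<not> (X = Y \<and> Y = Z)"
      using x1 x by auto
    moreover have "3 * sqrt 3 + k * (1 - x ^ 5) \<le> sqrt w"
      using s1 s2 s3 by linarith
    ultimately show ?thesis
      by blast
  qed
  then show "3 * sqrt 3 + k * (1 - x ^ 5) \<le> sqrt w"
    and "sqrt w = 3 * sqrt 3 + k * (1 - x ^ 5) \<longleftrightarrow>
      X = Y \<and> Y = Z \<or> k = sqrt 3 * bound c \<and> x = ratio c \<and> 108 * c ^ 6 / (3 * c\<^sup>2 - 1)\<^sup>2 = w"
    by auto
qed

text \<open>Equality in Blundon's bound makes two lengths agree, and \<open>isosceles_iff\<close>
  then applies to the three cyclic arrangements.\<close>

lemma extremal_triangle_iff:
  fixes X Y Z c :: real
  assumes pos: "0 < X" "0 < Y" "0 < Z" and c: "1 < c"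
  defines "y \<equiv> 3 * c\<^sup>2 - 1"
  shows "8 * X * Y * Z / ((X + Y) * (Y + Z) * (Z + X)) = ratio c \<and>
      108 * c ^ 6 / (3 * c\<^sup>2 - 1)\<^sup>2 = (X + Y + Z) ^ 3 / (X * Y * Z) \<longleftrightarrow>
    Y = Z \<and> 2 * Y = y * X \<or> Z = X \<and> 2 * Z = y * Y \<or> X = Y \<and> 2 * X = y * Z"
    (is "?E X Y Z \<longleftrightarrow> ?iso")
proof
  assume E: "?E X Y Z"
  then have "X = Y \<or> Y = Z \<or> Z = X"
    using blundon_lower(2)[OF pos, of c] c by simp
  moreover have "2 * Y = y * X" if "Y = Z"
    using E isosceles_iff[of X Y c] pos c that by (simp add: y_def)
  moreover have "2 * Z = y * Y" if "Z = X"
    using E isosceles_iff[of Y Z c] pos c that by (simp add: y_def ac_simps)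
  moreover have "2 * X = y * Z" if "X = Y"
    using E isosceles_iff[of Z X c] pos c that by (simp add: y_def ac_simps)
  ultimately show ?iso by auto
next
  assume ?iso
  then consider "Y = Z" "2 * Y = y * X" | "Z = X" "2 * Z = y * Y" | "X = Y" "2 * X = y * Z"
    by auto
  then show "?E X Y Z"
  proof cases
    case 1
    then show ?thesis using isosceles_iff[of X Y c] pos c by (simp add: y_def)
  next
    case 2
    then show ?thesis using isosceles_iff[of Y Z c] pos c by (simp add: y_def ac_simps)
  next
    case 3
    then show ?thesis using isosceles_iff[of Z X c] pos c by (simp add: y_def ac_simps)
  qed
qed

section \<open>Return from tangent lengths to side lengths\<close>

theorem theorem2:
  fixes k0 t1 k a b c :: real
  assumes k0_int: "1/2 < k0" "k0 < 9/13" and k0_root: "p4 k0 = 0"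
    and t1_int: "1/2 < t1" "t1 < 3/5" and t1_root: "p2 t1 = 0"
    and hk: "k \<le> k0"
    and tri: "is_triangle a b c"
  defines "p \<equiv> semiperim a b c" and "r \<equiv> inradius a b c" and "R \<equiv> circumradius a b c"
  shows "p \<ge> 3 * sqrt 3 * r + k * (1 - (2 * r / R) ^ 5) * r \<and>
         (p = 3 * sqrt 3 * r + k * (1 - (2 * r / R) ^ 5) * r \<longleftrightarrow>
           (a = b \<and> b = c) \<or>
           (k = k0 \<and> ((a = 2 * t1 * b \<and> b = c) \<or> (b = 2 * t1 * c \<and> c = a) \<or> (c = 2 * t1 * a \<and> a = b))))"
proof -
  \<comment> \<open>This inverts t = (3v^2 - 1)/(3v^2 + 1); the interval for \<open>t1\<close>
    becomes 1 < v^2 < 4/3, and 4/3 < (6/5)^2.\<close>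
  define v where "v = sqrt ((1 + t1) / (3 * (1 - t1)))"
  have v2: "v\<^sup>2 = (1 + t1) / (3 * (1 - t1))"
    using t1_int by (simp add: v_def)
  have v: "1 < v"
    using t1_int by (simp add: v_def field_simps)
  have "v\<^sup>2 < (6 / 5)\<^sup>2"
    using t1_int unfolding v2 by (simp add: field_simps power2_eq_square)
  then have "v < 6 / 5"
    by (rule power_less_imp_less_base) simp
  have y: "3 * v\<^sup>2 - 1 = 2 * t1 / (1 - t1)" and z: "3 * v\<^sup>2 + 1 = 2 / (1 - t1)"
    using t1_int unfolding v2 by (simp_all add: field_simps)
  then have "(3 * v\<^sup>2 - 1) / (3 * v\<^sup>2 + 1) = t1"
    using t1_int by simp
  with t1_root have crit: "poly crit v = 0"
    using p2_root_imp_crit_root[OF v \<open>v < 6 / 5\<close>] by simp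
  have k0: "k0 = sqrt 3 * bound v"
    using k0_eq_critical_value[OF k0_int k0_root v crit] bound_at_critical[OF v crit] by simp

  \<comment> \<open>With tangent lengths as variables the triangle inequalities become positivity,
    and Heron's formula expresses r and R through them.\<close>
  define X Y Z where "X = p - a" and "Y = p - b" and "Z = p - c"
  have abc: "a = Y + Z" "b = Z + X" "c = X + Y" and p: "p = X + Y + Z"
    by (simp_all add: X_def Y_def Z_def p_def semiperim_def field_simps)
  have pos: "0 < X" "0 < Y" "0 < Z"
    using tri by (simp_all add: X_def Y_def Z_def p_def semiperim_def is_triangle_def field_simps)
  define x w where "x = 8 * X * Y * Z / ((X + Y) * (Y + Z) * (Z + X))"
    and "w = (X + Y + Z) ^ 3 / (X * Y * Z)"
  define A where "A = tri_area a b c"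
  have A2: "A\<^sup>2 = p * (X * Y * Z)" and A: "0 < A"
    using pos p unfolding A_def tri_area_def Let_def p_def[symmetric] X_def[symmetric]
      Y_def[symmetric] Z_def[symmetric] by (simp_all add: mult.assoc)
  have "0 < p" using pos p by simp
  have r: "r = A / p" and "0 < r"
    using \<open>0 < p\<close> A by (simp_all add: r_def inradius_def A_def p_def)
  have "2 * r / R = 8 * A\<^sup>2 / (p * (a * b * c))"
    by (simp add: r R_def circumradius_def power2_eq_square flip: A_def)
  also have "\<dots> = x"
    unfolding A2 using \<open>0 < p\<close> by (simp add: x_def abc ac_simps)
  finally have x: "2 * r / R = x" .
  have "(p / r)\<^sup>2 = w"
    using A2 A \<open>0 < p\<close> pos by (simp add: r w_def p[symmetric] divide_simps power2_eq_square power3_eq_cube)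
  then have "p / r = sqrt w"
    using \<open>0 < p\<close> \<open>0 < r\<close> by (simp add: real_sqrt_unique)
  then have pr: "p = sqrt w * r"
    using \<open>0 < r\<close> by (simp add: field_simps)
  have rhs: "3 * sqrt 3 * r + k * (1 - (2 * r / R) ^ 5) * r = (3 * sqrt 3 + k * (1 - x ^ 5)) * r"
    unfolding x by (simp add: algebra_simps)

  \<comment> \<open>For S the repeated tangent length and T the other one, the sides are S + S and
    twice S + T, so the ratio becomes 2 t1 : 1 : 1.\<close>
  have iso: "2 * S = (3 * v\<^sup>2 - 1) * T \<longleftrightarrow> S + S = 2 * t1 * (S + T)" for S T :: real
    using t1_int unfolding y by (simp add: field_simps)
  have extremal: "x = ratio v \<and> 108 * v ^ 6 / (3 * v\<^sup>2 - 1)\<^sup>2 = w \<longleftrightarrow>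
      (a = 2 * t1 * b \<and> b = c) \<or> (b = 2 * t1 * c \<and> c = a) \<or> (c = 2 * t1 * a \<and> a = b)"
    unfolding x_def w_def extremal_triangle_iff[OF pos v] iso abc by (auto simp: ac_simps)
  have equi: "X = Y \<and> Y = Z \<longleftrightarrow> a = b \<and> b = c"
    unfolding abc by auto
  have "3 * sqrt 3 + k * (1 - x ^ 5) \<le> sqrt w"
    and "sqrt w = 3 * sqrt 3 + k * (1 - x ^ 5) \<longleftrightarrow>
      (X = Y \<and> Y = Z) \<or> (k = k0 \<and> x = ratio v \<and> 108 * v ^ 6 / (3 * v\<^sup>2 - 1)\<^sup>2 = w)"
    using tangent_length_inequality[OF pos v crit, of k] hk unfolding k0 x_def w_def by simp_all
  then show ?thesis
    unfolding rhs unfolding pr equi extremal using \<open>0 < r\<close> by simp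
qed

end
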